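(* Let $\mu$ be a regular isotropic log-concave target on $\mathbb R^n$ with moment potential $\psi$, let $U$ have law $e^{-\psi(u)}du$, and put $Y=\nabla\psi(U)\sim\mu$ and $H=\nabla^2\psi(U)$. Suppose that $\mathbb E\operatorname{Tr}(H^2)<\infty$. For a deterministic symmetric matrix $A\in\mathbb R^{n\times n}$ put $$f_A=\operatorname{Tr}(AH),\quad q_A=Y^{\mathsf T}AY,\quad T_A=\mathbb E\,(AY)^{\mathsf T}H(AY),\quad U_A=\mathbb E\operatorname{Tr}(AHAH).$$ Then, for every such $A$, $$\operatorname{Var}(f_A)=\operatorname{Var}(q_A)-3T_A+U_A.$$
   Context: A random vector $Y\in\mathbb R^n$ is isotropic if $\mathbb E Y=0$ and $\mathbb E(YY^{\mathsf T})=I_n$. Regular isotropic log-concave target and moment potential: a regular isotropic log-concave target on $\mathbb R^n$ is an isotropic probability measure $d\mu(y)=e^{-V(y)}\mathbf 1_K(y)\,dy$, where $K\subset\mathbb R^n$ is bounded, open and convex and $V$ is smooth and convex on a neighborhood of $\overline K$. By the moment-measure theorem there is a smooth strictly convex $\psi:\mathbb R^n\to\mathbb R$ (the moment potential), unique up to translation, with $\int e^{-\psi}=1$, such that if $U$ has law $d\nu(u)=e^{-\psi(u)}du$ then $\nabla\psi(U)\sim\mu$; moreover $\nabla\psi:\mathbb R^n\to K$ is a diffeomorphism. *)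

theory Defs
  imports "HOL-Probability.Probability"
begin

text \<open>\<open>C_k_on k S f\<close> is meaningful for open \<open>S\<close>: all iterated directional derivatives of \<open>f\<close> of
  order less than \<open>k\<close> are Frechet differentiable on \<open>S\<close>, and those of order \<open>k\<close> are continuous.\<close>

primrec C_k_on ::
  "nat \<Rightarrow> 'a::real_normed_vector set \<Rightarrow> ('a \<Rightarrow> 'b::real_normed_vector) \<Rightarrow> bool"
where
  "C_k_on 0 S f \<longleftrightarrow> continuous_on S f"
| "C_k_on (Suc k) S f \<longleftrightarrow>
     (\<forall>x\<in>S. f differentiable (at x)) \<and>
     (\<forall>v. C_k_on k S (\<lambda>x. frechet_derivative f (at x) v))"

definition smooth_on :: "'a::real_normed_vector set \<Rightarrow> ('a \<Rightarrow> 'b::real_normed_vector) \<Rightarrow> bool"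
  where "smooth_on S f \<longleftrightarrow> open S \<and> (\<forall>k. C_k_on k S f)"

definition strictly_convex_on :: "'a::real_vector set \<Rightarrow> ('a \<Rightarrow> real) \<Rightarrow> bool"
  where "strictly_convex_on S f \<longleftrightarrow> convex S \<and>
    (\<forall>x\<in>S. \<forall>y\<in>S. \<forall>u>0. \<forall>v>0. x \<noteq> y \<longrightarrow> u + v = 1 \<longrightarrow>
       f (u *\<^sub>R x + v *\<^sub>R y) < u * f x + v * f y)"

definition gradient :: "(real^'n \<Rightarrow> real) \<Rightarrow> real^'n \<Rightarrow> real^'n"
  where "gradient f x = (\<chi> i. frechet_derivative f (at x) (axis i 1))"

definition hessian :: "(real^'n \<Rightarrow> real) \<Rightarrow> real^'n \<Rightarrow> real^'n^'n"
  where "hessian f x = jacobian (gradient f) (at x)"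

definition isotropic :: "'a measure \<Rightarrow> ('a \<Rightarrow> real^'n) \<Rightarrow> bool"
  where "isotropic M Y \<longleftrightarrow> prob_space M \<and> Y \<in> borel_measurable M \<and>
    integrable M Y \<and> prob_space.expectation M Y = 0 \<and>
    integrable M (\<lambda>\<omega>. (\<chi> i j. Y \<omega> $ i * Y \<omega> $ j) :: real^'n^'n) \<and>
    prob_space.expectation M (\<lambda>\<omega>. (\<chi> i j. Y \<omega> $ i * Y \<omega> $ j) :: real^'n^'n) = mat 1"

text \<open>The neighbourhood \<open>W\<close> of \<open>closure K\<close> may be taken convex without loss of generality, since
  \<open>closure K\<close> is compact and convex; \<open>convex_on W V\<close> includes convexity of \<open>W\<close>.\<close>

definition regular_isotropic_log_concave :: "(real^'n) measure \<Rightarrow> bool"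
  where "regular_isotropic_log_concave \<mu> \<longleftrightarrow>
    isotropic \<mu> (\<lambda>y. y) \<and>
    (\<exists>K V W. bounded K \<and> open K \<and> convex K \<and>
       closure K \<subseteq> W \<and> smooth_on W V \<and> convex_on W V \<and>
       \<mu> = density lborel (\<lambda>y. ennreal (exp (- V y) * indicator K y)))"

definition moment_potential :: "(real^'n) measure \<Rightarrow> (real^'n \<Rightarrow> real) \<Rightarrow> bool"
  where "moment_potential \<mu> \<psi> \<longleftrightarrow>
    smooth_on UNIV \<psi> \<and> strictly_convex_on UNIV \<psi> \<and>
    (\<integral>\<^sup>+ u. ennreal (exp (- \<psi> u)) \<partial>lborel) = 1 \<and>
    distr (density lborel (\<lambda>u. ennreal (exp (- \<psi> u)))) borel (gradient \<psi>) = \<mu>"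

end

theory Submission
  imports Defs
begin

text \<open>All identities are instances of \<open>\<integral> div W d\<nu> = \<integral> \<langle>W, \<nabla>\<psi>\<rangle> d\<nu>\<close> for \<open>d\<nu> = exp (- \<psi>) du\<close>.
  With \<open>Y = \<nabla>\<psi>\<close>, the field \<open>W = A Y\<close> gives \<open>E f = E q\<close>, and \<open>W = q A Y\<close> gives
  \<open>E q\<^sup>2 = E (q f) + 2 T\<close>. The field \<open>W = f A Y - A H A Y\<close> has divergence \<open>f\<^sup>2 - Tr (A H A H)\<close>, since
  the third derivatives of \<open>\<psi>\<close> cancel, which gives \<open>E f\<^sup>2 - U = E (q f) - T\<close>. Because \<open>Y\<close> is
  bounded and \<open>H\<close> square integrable, all these fields, fluxes and divergences are integrable, so a cutoff
  removes the boundary term.\<close>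

section \<open>Directional derivatives\<close>

text \<open>A derivative along one fixed direction, given as a function on the whole space.
  Integration by parts acts in one direction at a time, and sums and products stay in this class by
  one-variable calculus.\<close>

definition has_dir_deriv ::
  "('a::real_normed_vector \<Rightarrow> real) \<Rightarrow> 'a \<Rightarrow> ('a \<Rightarrow> real) \<Rightarrow> bool"
  where "has_dir_deriv g v g' \<longleftrightarrow>
    (\<forall>x. ((\<lambda>t. g (x + t *\<^sub>R v)) has_real_derivative g' x) (at 0))"

text \<open>The definition differentiates at parameter \<open>0\<close> for every base point; moving
  the base point along the line gives the derivative at every parameter, which is the form that the
  mean value theorem takes.\<close>

lemma has_dir_derivD:
  assumes "has_dir_deriv g v g'"
  shows "((\<lambda>t. g (x + t *\<^sub>R v)) has_real_derivative g' (x + t *\<^sub>R v)) (at t)"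
proof -
  have "((\<lambda>s. g ((x + t *\<^sub>R v) + s *\<^sub>R v)) has_real_derivative g' (x + t *\<^sub>R v)) (at 0)"
    using assms by (simp add: has_dir_deriv_def)
  then have "((\<lambda>s. g (x + (s + t) *\<^sub>R v)) has_real_derivative g' (x + t *\<^sub>R v)) (at 0)"
    by (simp add: algebra_simps)
  then show ?thesis
    using DERIV_shift[of "\<lambda>s. g (x + s *\<^sub>R v)" "g' (x + t *\<^sub>R v)" 0 t] by simp
qed

lemma has_dir_deriv_const: "has_dir_deriv (\<lambda>x. c) v (\<lambda>x. 0)"
  by (simp add: has_dir_deriv_def)

lemma has_dir_deriv_diff:
  "has_dir_deriv g v g' \<Longrightarrow> has_dir_deriv h v h' \<Longrightarrow>
    has_dir_deriv (\<lambda>x. g x - h x) v (\<lambda>x. g' x - h' x)"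
  by (auto simp: has_dir_deriv_def intro!: DERIV_diff)

lemma has_dir_deriv_mult:
  assumes "has_dir_deriv g v g'" "has_dir_deriv h v h'"
  shows "has_dir_deriv (\<lambda>x. g x * h x) v (\<lambda>x. g' x * h x + g x * h' x)"
  unfolding has_dir_deriv_def
proof
  fix x
  have "((\<lambda>t. g (x + t *\<^sub>R v)) has_real_derivative g' x) (at 0)"
    "((\<lambda>t. h (x + t *\<^sub>R v)) has_real_derivative h' x) (at 0)"
    using assms by (auto simp: has_dir_deriv_def)
  from DERIV_mult[OF this]
  show "((\<lambda>t. g (x + t *\<^sub>R v) * h (x + t *\<^sub>R v)) has_real_derivative g' x * h x + g x * h' x) (at 0)"
    by (simp add: mult.commute add.commute)
qed

lemma has_dir_deriv_cmult:
  "has_dir_deriv g v g' \<Longrightarrow> has_dir_deriv (\<lambda>x. c * g x) v (\<lambda>x. c * g' x)"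
  using has_dir_deriv_mult[OF has_dir_deriv_const, of g v g' c] by simp

lemma has_dir_deriv_sum:
  "(\<And>i. i \<in> I \<Longrightarrow> has_dir_deriv (g i) v (g' i)) \<Longrightarrow>
    has_dir_deriv (\<lambda>x. \<Sum>i\<in>I. g i x) v (\<lambda>x. \<Sum>i\<in>I. g' i x)"
  by (auto simp: has_dir_deriv_def intro!: DERIV_sum)

lemma has_dir_deriv_compose:
  assumes "has_dir_deriv g v g'" "\<And>y. (f has_real_derivative f' y) (at y)"
  shows "has_dir_deriv (\<lambda>x. f (g x)) v (\<lambda>x. f' (g x) * g' x)"
  unfolding has_dir_deriv_def
proof
  fix x
  have "((\<lambda>t. g (x + t *\<^sub>R v)) has_real_derivative g' x) (at 0)"
    using assms by (auto simp: has_dir_deriv_def)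
  from DERIV_chain2[OF _ this, of f "f' (g x)"] assms(2)
  show "((\<lambda>t. f (g (x + t *\<^sub>R v))) has_real_derivative f' (g x) * g' x) (at 0)"
    by simp
qed

lemma has_derivative_imp_has_dir_deriv:
  assumes "\<And>x. (g has_derivative g' x) (at x)"
  shows "has_dir_deriv g v (\<lambda>x. g' x v)"
  unfolding has_dir_deriv_def
proof
  fix x
  have "((\<lambda>t. x + t *\<^sub>R v) has_derivative (\<lambda>t. t *\<^sub>R v)) (at 0)"
    by (auto intro!: derivative_eq_intros)
  moreover have "(g has_derivative g' x) (at (x + 0 *\<^sub>R v))"
    using assms by simp
  ultimately have "((\<lambda>t. g (x + t *\<^sub>R v)) has_derivative (\<lambda>t. g' x (t *\<^sub>R v))) (at 0)"
    by (rule has_derivative_compose)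
  moreover have "g' x (t *\<^sub>R v) = g' x v * t" for t
    using linear_cmul[OF has_derivative_linear[OF assms[of x]], of t v] by simp
  ultimately show "((\<lambda>t. g (x + t *\<^sub>R v)) has_real_derivative g' x v) (at 0)"
    by (simp add: has_field_derivative_def)
qed

text \<open>The mean value theorem is applied twice: first along \<open>u\<close> to the increment
  of \<open>g\<close> under the shift by \<open>h *\<^sub>R v\<close>, then along \<open>v\<close>
  to \<open>gu\<close>.\<close>

lemma double_difference_mean_value:
  assumes u: "has_dir_deriv g u gu" and uv: "has_dir_deriv gu v guv" and "0 < h"
  obtains s t where "0 < s" "s < h" "0 < t" "t < h"
    "g (x + h *\<^sub>R u + h *\<^sub>R v) - g (x + h *\<^sub>R u) - g (x + h *\<^sub>R v) + g x
      = h\<^sup>2 * guv (x + s *\<^sub>R u + t *\<^sub>R v)"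
proof -
  let ?p = "\<lambda>s. g ((x + h *\<^sub>R v) + s *\<^sub>R u) - g (x + s *\<^sub>R u)"
  have "(?p has_real_derivative gu ((x + h *\<^sub>R v) + s *\<^sub>R u) - gu (x + s *\<^sub>R u)) (at s)" for s
    by (intro DERIV_diff has_dir_derivD[OF u])
  from MVT2[OF \<open>0 < h\<close>, of ?p, OF this]
  obtain s where s: "0 < s" "s < h"
    and ps: "?p h - ?p 0 = h * (gu ((x + h *\<^sub>R v) + s *\<^sub>R u) - gu (x + s *\<^sub>R u))"
    by auto
  from MVT2[OF \<open>0 < h\<close>, of "\<lambda>t. gu ((x + s *\<^sub>R u) + t *\<^sub>R v)", OF has_dir_derivD[OF uv]]
  obtain t where t: "0 < t" "t < h"
    and pt: "gu ((x + s *\<^sub>R u) + h *\<^sub>R v) - gu (x + s *\<^sub>R u)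
      = h * guv ((x + s *\<^sub>R u) + t *\<^sub>R v)"
    by auto
  have eq: "(x + h *\<^sub>R v) + r *\<^sub>R u = (x + r *\<^sub>R u) + h *\<^sub>R v" for r
    by simp
  have "?p h - ?p 0 = h * (h * guv ((x + s *\<^sub>R u) + t *\<^sub>R v))"
    using ps pt unfolding eq by simp
  then have "g (x + h *\<^sub>R u + h *\<^sub>R v) - g (x + h *\<^sub>R u) - g (x + h *\<^sub>R v) + g x
      = h\<^sup>2 * guv (x + s *\<^sub>R u + t *\<^sub>R v)"
    unfolding eq by (simp add: power2_eq_square)
  with s t show ?thesis by (rule that)
qed

text \<open>The left-hand side of the previous identity is symmetric in \<open>u\<close> and \<open>v\<close>; let \<open>h\<close> tend to \<open>0\<close>.\<close>

lemma mixed_dir_derivs_commute: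
  assumes "has_dir_deriv g u gu" "has_dir_deriv gu v guv" "continuous_on UNIV guv"
    and "has_dir_deriv g v gv" "has_dir_deriv gv u gvu" "continuous_on UNIV gvu"
  shows "guv x = gvu x"
proof -
  \<comment> \<open>Each order of differentiation has its own intermediate point, with parameters
    below \<open>h\<close>. Both values, multiplied by \<open>h\<^sup>2\<close>, equal the same
    double difference and therefore agree.\<close>
  have "\<exists>s t s' t'. s \<in> {0..inverse (real (Suc n))} \<and> t \<in> {0..inverse (real (Suc n))} \<and>
     s' \<in> {0..inverse (real (Suc n))} \<and> t' \<in> {0..inverse (real (Suc n))} \<and>
     guv (x + s *\<^sub>R u + t *\<^sub>R v) = gvu (x + t' *\<^sub>R v + s' *\<^sub>R u)" for n
  proof -
    define h where "h = inverse (real (Suc n))"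
    have "0 < h" by (simp add: h_def)
    obtain s t where st: "0 < s" "s < h" "0 < t" "t < h"
      "g (x + h *\<^sub>R u + h *\<^sub>R v) - g (x + h *\<^sub>R u) - g (x + h *\<^sub>R v) + g x
        = h\<^sup>2 * guv (x + s *\<^sub>R u + t *\<^sub>R v)"
      using double_difference_mean_value[OF assms(1,2) \<open>0 < h\<close>] by metis
    obtain t' s' where st': "0 < t'" "t' < h" "0 < s'" "s' < h"
      "g (x + h *\<^sub>R v + h *\<^sub>R u) - g (x + h *\<^sub>R v) - g (x + h *\<^sub>R u) + g x
        = h\<^sup>2 * gvu (x + t' *\<^sub>R v + s' *\<^sub>R u)"
      using double_difference_mean_value[OF assms(4,5) \<open>0 < h\<close>] by metis
    have eq: "x + h *\<^sub>R v + h *\<^sub>R u = x + h *\<^sub>R u + h *\<^sub>R v" by simp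
    have "h\<^sup>2 * guv (x + s *\<^sub>R u + t *\<^sub>R v) = h\<^sup>2 * gvu (x + t' *\<^sub>R v + s' *\<^sub>R u)"
      using st(5) st'(5) unfolding eq by linarith
    then have "guv (x + s *\<^sub>R u + t *\<^sub>R v) = gvu (x + t' *\<^sub>R v + s' *\<^sub>R u)"
      using \<open>0 < h\<close> by simp
    then show ?thesis
      using st(1-4) st'(1-4) unfolding h_def[symmetric]
      by (intro exI[of _ s] exI[of _ t] exI[of _ s'] exI[of _ t']) auto
  qed
  then obtain s t s' t' where
    bd: "\<And>n. s n \<in> {0..inverse (real (Suc n))}" "\<And>n. t n \<in> {0..inverse (real (Suc n))}"
      "\<And>n. s' n \<in> {0..inverse (real (Suc n))}" "\<And>n. t' n \<in> {0..inverse (real (Suc n))}"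
    and eq: "\<And>n. guv (x + s n *\<^sub>R u + t n *\<^sub>R v) = gvu (x + t' n *\<^sub>R v + s' n *\<^sub>R u)"
    by metis
  have null: "r \<longlonglongrightarrow> 0" if "\<And>n. r n \<in> {0..inverse (real (Suc n))}" for r :: "nat \<Rightarrow> real"
    using that
    by (intro tendsto_sandwich[OF _ _ tendsto_const LIMSEQ_inverse_real_of_nat]) auto
  have "(\<lambda>n. x + s n *\<^sub>R u + t n *\<^sub>R v) \<longlonglongrightarrow> x + 0 *\<^sub>R u + 0 *\<^sub>R v"
    by (intro tendsto_intros null bd)
  then have 1: "(\<lambda>n. guv (x + s n *\<^sub>R u + t n *\<^sub>R v)) \<longlonglongrightarrow> guv x"
    using continuous_on_tendsto_compose[OF assms(3)] by simp
  have "(\<lambda>n. x + t' n *\<^sub>R v + s' n *\<^sub>R u) \<longlonglongrightarrow> x + 0 *\<^sub>R v + 0 *\<^sub>R u"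
    by (intro tendsto_intros null bd)
  then have "(\<lambda>n. gvu (x + t' n *\<^sub>R v + s' n *\<^sub>R u)) \<longlonglongrightarrow> gvu x"
    using continuous_on_tendsto_compose[OF assms(6)] by simp
  with 1 show ?thesis
    unfolding eq by (rule LIMSEQ_unique)
qed

section \<open>The divergence theorem for integrable fields\<close>

lemma continuous_imp_integrable_lborel_of_bounded_support:
  fixes g :: "'a::euclidean_space \<Rightarrow> real"
  assumes "continuous_on UNIV g" "\<And>x. R < norm x \<Longrightarrow> g x = 0"
  shows "integrable lborel g"
proof -
  have "integrable lborel (\<lambda>x. indicator (cball 0 R) x *\<^sub>R g x)"
    by (intro borel_integrable_compact compact_cball continuous_on_subset[OF assms(1)]) auto
  also have "(\<lambda>x. indicator (cball 0 R) x *\<^sub>R g x) = g"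
    using assms(2) by (auto split: split_indicator simp: fun_eq_iff)
  finally show ?thesis .
qed

text \<open>The set \<open>R < norm x\<close> is open, so along the line \<open>g\<close> is zero
  near parameter \<open>0\<close> and has the derivative of a constant there.\<close>

lemma has_dir_deriv_zero_outside:
  assumes "has_dir_deriv g v g'" "\<And>x. R < norm x \<Longrightarrow> g x = 0" "R < norm x"
  shows "g' x = 0"
proof -
  have D: "((\<lambda>t. g (x + t *\<^sub>R v)) has_real_derivative g' x) (at 0)"
    using assms(1) by (simp add: has_dir_deriv_def)
  have "((\<lambda>t. norm (x + t *\<^sub>R v)) \<longlongrightarrow> norm (x + 0 *\<^sub>R v)) (at 0)"
    by (intro tendsto_intros)
  then have "\<forall>\<^sub>F t in at 0. R < norm (x + t *\<^sub>R v)"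
    using assms(3) by (intro order_tendstoD(1)) auto
  then have "\<forall>\<^sub>F t in at 0. g (x + t *\<^sub>R v) = 0"
    by eventually_elim (rule assms(2))
  then have ev: "\<forall>\<^sub>F t in nhds 0. g (x + t *\<^sub>R v) = 0"
    using assms(2,3) by (simp add: eventually_nhds_conv_at)
  have "((\<lambda>t. 0) has_real_derivative g' x) (at 0)"
    using D DERIV_cong_ev[OF refl ev refl] by simp
  then show ?thesis
    using DERIV_unique[OF _ DERIV_const] by blast
qed

text \<open>Translation invariance makes the difference quotients of \<open>g\<close> integrate to zero.\<close>

lemma integral_dir_deriv_eq_zero:
  fixes g :: "'a::euclidean_space \<Rightarrow> real"
  assumes cont: "continuous_on UNIV g" "continuous_on UNIV g'"
    and deriv: "has_dir_deriv g v g'"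
    and supp: "\<And>x. R < norm x \<Longrightarrow> g x = 0"
  shows "integral\<^sup>L lborel g' = 0"
proof -
  define h where "h n = inverse (real (Suc n))" for n
  have h: "0 < h n" "h n \<le> 1" for n
    by (auto simp: h_def field_simps)
  define s where "s n x = (g (x + h n *\<^sub>R v) - g x) / h n" for n x
  \<comment> \<open>The radius leaves room for the mean value point \<open>x + t *\<^sub>R v\<close>
    with \<open>t < 1\<close>, when \<open>x\<close> ranges over the ball of radius
    \<open>R + norm v\<close>.\<close>
  define B where "B = (SUP x\<in>cball 0 (R + 2 * norm v). \<bar>g' x\<bar>)"
  have [measurable]: "g \<in> borel_measurable borel" "g' \<in> borel_measurable borel"
    using cont by (auto intro: borel_measurable_continuous_onI)
  have bound: "\<bar>g' x\<bar> \<le> B" if "norm x \<le> R + 2 * norm v" for x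
    unfolding B_def
  proof (rule cSUP_upper)
    have "compact ((\<lambda>x. \<bar>g' x\<bar>) ` cball 0 (R + 2 * norm v))"
      by (intro compact_continuous_image continuous_intros continuous_on_subset[OF cont(2)]) auto
    then show "bdd_above ((\<lambda>x. \<bar>g' x\<bar>) ` cball 0 (R + 2 * norm v))"
      by (intro bounded_imp_bdd_above compact_imp_bounded)
  qed (use that in auto)
  \<comment> \<open>Inside the ball the quotient is a value of \<open>g'\<close>; outside it both
    \<open>x\<close> and the shifted point have norm above \<open>R\<close>, so the quotient is
    zero.\<close>
  have s_bound: "norm (s n x) \<le> indicator (cball 0 (R + norm v)) x * B" for n x
  proof (cases "norm x \<le> R + norm v")
    case True
    obtain t where t: "0 < t" "t < h n"
      "g (x + h n *\<^sub>R v) - g (x + 0 *\<^sub>R v) = (h n - 0) * g' (x + t *\<^sub>R v)"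
      using MVT2[OF h(1)[of n], of "\<lambda>t. g (x + t *\<^sub>R v)", OF has_dir_derivD[OF deriv]] by metis
    have "norm (x + t *\<^sub>R v) \<le> norm x + t * norm v"
      using norm_triangle_ineq[of x "t *\<^sub>R v"] t by simp
    also have "t * norm v \<le> 1 * norm v"
      using t h(2)[of n] by (intro mult_right_mono) auto
    finally have "\<bar>g' (x + t *\<^sub>R v)\<bar> \<le> B"
      using True by (intro bound) auto
    moreover have "s n x = g' (x + t *\<^sub>R v)"
      using t h(1)[of n] by (simp add: s_def)
    ultimately show ?thesis
      using True by simp
  next
    case False
    have "h n * norm v \<le> norm v"
      using mult_right_mono[OF h(2)[of n], of "norm v"] by simp
    moreover have "norm x \<le> norm (x + h n *\<^sub>R v) + norm (h n *\<^sub>R v)"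
      using norm_triangle_ineq4[of "x + h n *\<^sub>R v" "h n *\<^sub>R v"] by simp
    ultimately have "R < norm (x + h n *\<^sub>R v)"
      using False h(1)[of n] by simp
    moreover have "R < norm x"
      using False norm_ge_zero[of v] by linarith
    ultimately show ?thesis
      using False by (simp add: s_def supp)
  qed
  have "(\<lambda>n. integral\<^sup>L lborel (s n)) \<longlonglongrightarrow> integral\<^sup>L lborel g'"
  proof (rule integral_dominated_convergence)
    show "integrable lborel (\<lambda>x. indicator (cball 0 (R + norm v)) x * B :: real)"
      by (intro integrable_mult_left integrable_real_indicator emeasure_compact_finite) auto
    show "AE x in lborel. (\<lambda>n. s n x) \<longlonglongrightarrow> g' x"
    proof (rule AE_I2)
      fix x
      have "((\<lambda>t. (g (x + t *\<^sub>R v) - g x) / t) \<longlongrightarrow> g' x) (at 0)"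
        using deriv by (simp add: has_dir_deriv_def has_field_derivative_iff)
      moreover have "filterlim h (at 0) sequentially"
        using h(1) LIMSEQ_inverse_real_of_nat
        by (auto simp: filterlim_at h_def[abs_def] less_imp_neq[THEN not_sym])
      ultimately show "(\<lambda>n. s n x) \<longlonglongrightarrow> g' x"
        unfolding s_def by (rule filterlim_compose)
    qed
    show "AE x in lborel. norm (s n x) \<le> indicator (cball 0 (R + norm v)) x * B" for n
      using s_bound by auto
    show "s n \<in> borel_measurable lborel" for n
      unfolding s_def[abs_def] by measurable
  qed simp
  moreover have "integral\<^sup>L lborel (s n) = 0" for n
  proof -
    have g: "integrable lborel g"
      using cont(1) supp by (rule continuous_imp_integrable_lborel_of_bounded_support)
    have tr: "lborel = distr lborel borel (\<lambda>x. x + h n *\<^sub>R v)"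
      using lborel_distr_plus[of "h n *\<^sub>R v"] by (simp add: add.commute[of _ "h n *\<^sub>R v"])
    have "integrable (distr lborel borel (\<lambda>x. x + h n *\<^sub>R v)) g"
      using g tr by simp
    then have "integrable lborel (\<lambda>x. g (x + h n *\<^sub>R v))"
      by (subst (asm) integrable_distr_eq) auto
    moreover have "integral\<^sup>L (distr lborel borel (\<lambda>x. x + h n *\<^sub>R v)) g = integral\<^sup>L lborel g"
      using tr by simp
    then have "(\<integral>x. g (x + h n *\<^sub>R v) \<partial>lborel) = integral\<^sup>L lborel g"
      by (subst (asm) integral_distr) auto
    ultimately show ?thesis
      using g by (simp add: s_def[abs_def])
  qed
  ultimately show ?thesis
    by (simp add: LIMSEQ_const_iff)
qed

text \<open>A truncated paraboloid, equal to \<open>1\<close> at the origin and supported in the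
  ball of radius \<open>R\<close>. The outer square removes the kink of the positive part on the
  sphere, so that the directional derivatives are continuous and explicit.\<close>

definition cutoff :: "real \<Rightarrow> 'a::real_inner \<Rightarrow> real"
  where "cutoff R x = (max 0 (1 - (x \<bullet> x) / R\<^sup>2))\<^sup>2"

definition cutoff_deriv :: "real \<Rightarrow> 'a::real_inner \<Rightarrow> 'a \<Rightarrow> real"
  where "cutoff_deriv R v x = - 4 * max 0 (1 - (x \<bullet> x) / R\<^sup>2) * (x \<bullet> v) / R\<^sup>2"

text \<open>Away from \<open>0\<close> the function agrees locally with a square or with zero. At
  the gluing point the difference quotient in \<open>h\<close> is at most
  \<open>\<bar>h\<bar>\<close>.\<close>

lemma DERIV_max_zero_square: "((\<lambda>y::real. (max 0 y)\<^sup>2) has_real_derivative 2 * max 0 y) (at y)"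
proof -
  have "((\<lambda>y::real. (max 0 y)\<^sup>2) has_real_derivative 0) (at 0)"
    unfolding DERIV_def
  proof (rule Lim_null_comparison)
    show "\<forall>\<^sub>F h in at 0. norm (((max 0 (0 + h))\<^sup>2 - (max 0 0)\<^sup>2) / h) \<le> \<bar>h::real\<bar>"
      by (intro always_eventually) (auto simp: max_def power2_eq_square)
    show "((\<lambda>h::real. \<bar>h\<bar>) \<longlongrightarrow> 0) (at 0)"
      using tendsto_rabs_zero tendsto_ident_at by blast
  qed
  moreover have "((\<lambda>y::real. (max 0 y)\<^sup>2) has_real_derivative 2 * y) (at y)" if "y > 0"
  proof (rule DERIV_cong_ev[THEN iffD1, OF refl _ refl])
    show "((\<lambda>y::real. y\<^sup>2) has_real_derivative 2 * y) (at y)"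
      by (auto intro!: derivative_eq_intros)
    show "\<forall>\<^sub>F x in nhds y. x\<^sup>2 = (max 0 x)\<^sup>2"
      using eventually_nhds_in_open[of "{0<..}" y] that by (auto elim!: eventually_mono)
  qed
  moreover have "((\<lambda>y::real. (max 0 y)\<^sup>2) has_real_derivative 0) (at y)" if "y < 0"
  proof (rule DERIV_cong_ev[THEN iffD1, OF refl _ refl])
    show "((\<lambda>y::real. 0) has_real_derivative 0) (at y)"
      by simp
    show "\<forall>\<^sub>F x::real in nhds y. 0 = (max 0 x)\<^sup>2"
      using eventually_nhds_in_open[of "{..<0}" y] that by (auto elim!: eventually_mono)
  qed
  ultimately show ?thesis
    by (cases y "0::real" rule: linorder_cases) auto
qed

lemma has_dir_deriv_cutoff: "has_dir_deriv (cutoff R) v (cutoff_deriv R v)"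
proof -
  have "((\<lambda>x. 1 - c * (x \<bullet> x)) has_derivative (\<lambda>h. - (c * (2 * (x \<bullet> h))))) (at x)" for c and x :: 'a
    by (auto intro!: derivative_eq_intros simp: inner_commute)
  from has_derivative_imp_has_dir_deriv[OF this, of "inverse (R\<^sup>2)"]
  have "has_dir_deriv (\<lambda>x. 1 - (x \<bullet> x) / R\<^sup>2) v (\<lambda>x. - (2 * (x \<bullet> v)) / R\<^sup>2)"
    by (simp add: divide_inverse mult.commute)
  from has_dir_deriv_compose[OF this DERIV_max_zero_square]
  show ?thesis
    by (simp add: cutoff_def[abs_def] cutoff_deriv_def[abs_def] algebra_simps)
qed

lemma continuous_on_cutoff: "continuous_on S (cutoff R)"
  unfolding cutoff_def[abs_def] divide_inverse by (intro continuous_intros)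

lemma continuous_on_cutoff_deriv: "continuous_on S (cutoff_deriv R v)"
  unfolding cutoff_deriv_def[abs_def] divide_inverse by (intro continuous_intros)

lemma cutoff_zero_outside:
  assumes "0 < R" "R < norm x"
  shows "cutoff R x = 0"
proof -
  have "R\<^sup>2 \<le> x \<bullet> x"
    using assms by (simp add: power2_norm_eq_inner[symmetric] power_mono)
  then show ?thesis
    using assms by (simp add: cutoff_def max_def field_simps)
qed

lemma cutoff_nonneg_le_one: "0 \<le> cutoff R x" "cutoff R x \<le> 1"
  by (auto simp: cutoff_def intro!: power_le_one)

text \<open>Inside the ball, Cauchy-Schwarz bounds \<open>x \<bullet> v\<close> by
  \<open>R * norm v\<close>, so that one factor \<open>1 / R\<close> remains; outside, the
  derivative vanishes. This decay is what makes the boundary term disappear.\<close>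

lemma abs_cutoff_deriv_le:
  assumes "0 < R"
  shows "\<bar>cutoff_deriv R v x\<bar> \<le> 4 * norm v / R"
proof (cases "norm x \<le> R")
  case True
  have "\<bar>x \<bullet> v\<bar> \<le> R * norm v"
    using Cauchy_Schwarz_ineq2[of x v] mult_right_mono[OF True, of "norm v"] by simp
  moreover have "\<bar>max 0 (1 - (x \<bullet> x) / R\<^sup>2)\<bar> \<le> 1"
    by auto
  ultimately have "\<bar>max 0 (1 - (x \<bullet> x) / R\<^sup>2)\<bar> * \<bar>x \<bullet> v\<bar> \<le> 1 * (R * norm v)"
    by (intro mult_mono) auto
  then show ?thesis
    using assms by (simp add: cutoff_deriv_def abs_mult power2_eq_square field_simps)
next
  case False
  then have "R\<^sup>2 \<le> x \<bullet> x"
    using assms by (simp add: power2_norm_eq_inner[symmetric] power_mono)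
  then show ?thesis
    using assms by (simp add: cutoff_deriv_def max_def field_simps)
qed

lemma cutoff_tendsto_one: "(\<lambda>n. cutoff (real (Suc n)) x) \<longlonglongrightarrow> 1"
proof -
  have "(\<lambda>n. (max 0 (1 - (x \<bullet> x) * (inverse (real (Suc n)))\<^sup>2))\<^sup>2) \<longlonglongrightarrow> (max 0 (1 - (x \<bullet> x) * 0\<^sup>2))\<^sup>2"
    by (intro tendsto_intros LIMSEQ_inverse_real_of_nat)
  then show ?thesis
    by (simp add: cutoff_def divide_inverse power_inverse)
qed

lemma cutoff_deriv_tendsto_zero: "(\<lambda>n. cutoff_deriv (real (Suc n)) v x) \<longlonglongrightarrow> 0"
proof (rule Lim_null_comparison)
  show "\<forall>\<^sub>F n in sequentially. norm (cutoff_deriv (real (Suc n)) v x)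
      \<le> 4 * norm v * inverse (real (Suc n))"
    using abs_cutoff_deriv_le[of "real (Suc _)" v x]
    by (intro always_eventually) (simp add: divide_inverse del: of_nat_Suc)
  show "(\<lambda>n. 4 * norm v * inverse (real (Suc n))) \<longlonglongrightarrow> 0"
    using tendsto_mult_right_zero[OF LIMSEQ_inverse_real_of_nat] by blast
qed

text \<open>The field times a cutoff has bounded support, so its divergence integrates to zero, and
  dominated convergence lets the radius grow. Integrability is asked of the divergence as a whole,
  since the summands \<open>d i\<close> may be integrable only through cancellation.\<close>

lemma integral_divergence_eq_zero:
  fixes w :: "'i \<Rightarrow> 'a::euclidean_space \<Rightarrow> real"
  assumes "finite I"
    and cont: "\<And>i. i \<in> I \<Longrightarrow> continuous_on UNIV (w i)" "\<And>i. i \<in> I \<Longrightarrow> continuous_on UNIV (d i)"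
    and deriv: "\<And>i. i \<in> I \<Longrightarrow> has_dir_deriv (w i) (e i) (d i)"
    and int_w: "\<And>i. i \<in> I \<Longrightarrow> integrable lborel (w i)"
    and int_div: "integrable lborel (\<lambda>x. \<Sum>i\<in>I. d i x)"
  shows "(\<integral>x. (\<Sum>i\<in>I. d i x) \<partial>lborel) = 0"
proof -
  define D where "D n i x = cutoff_deriv (real (Suc n)) (e i) x * w i x
      + cutoff (real (Suc n)) x * d i x" for n i x
  have D: "has_dir_deriv (\<lambda>x. cutoff (real (Suc n)) x * w i x) (e i) (D n i)" if "i \<in> I" for n i
    unfolding D_def[abs_def] by (intro has_dir_deriv_mult has_dir_deriv_cutoff deriv that)
  have contD: "continuous_on UNIV (D n i)" if "i \<in> I" for n i
    unfolding D_def[abs_def]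
    by (intro continuous_intros continuous_on_cutoff continuous_on_cutoff_deriv cont that)
  have supp: "cutoff (real (Suc n)) x * w i x = 0" if "real (Suc n) < norm x" for n i x
    using cutoff_zero_outside[OF _ that] by simp
  have intD: "integrable lborel (D n i)" if "i \<in> I" for n i
    by (rule continuous_imp_integrable_lborel_of_bounded_support[OF contD[OF that]],
        rule has_dir_deriv_zero_outside[OF D[OF that] supp])
  have zero: "(\<integral>x. (\<Sum>i\<in>I. D n i x) \<partial>lborel) = 0" for n
  proof -
    have "integral\<^sup>L lborel (D n i) = 0" if "i \<in> I" for i
      by (rule integral_dir_deriv_eq_zero[OF _ contD[OF that] D[OF that] supp])
        (intro continuous_intros continuous_on_cutoff cont that)
    then show ?thesis
      using intD by (simp add: Bochner_Integration.integral_sum)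
  qed
  have "(\<lambda>n. \<integral>x. (\<Sum>i\<in>I. D n i x) \<partial>lborel) \<longlonglongrightarrow> (\<integral>x. (\<Sum>i\<in>I. d i x) \<partial>lborel)"
  proof (rule integral_dominated_convergence)
    \<comment> \<open>All radii \<open>Suc n\<close> are at least \<open>1\<close>, so the
      derivative of the cutoff is at most \<open>4 * norm (e i)\<close>. The cutoff itself is common
      to all components and factors out of the sum, which leaves the full divergence as the second
      bound.\<close>
    show "integrable lborel (\<lambda>x. (\<Sum>i\<in>I. 4 * norm (e i) * \<bar>w i x\<bar>) + \<bar>\<Sum>i\<in>I. d i x\<bar>)"
      by (intro Bochner_Integration.integrable_add integrable_abs[OF int_div]
          Bochner_Integration.integrable_sum integrable_mult_right integrable_abs int_w)
    show "AE x in lborel. (\<lambda>n. \<Sum>i\<in>I. D n i x) \<longlonglongrightarrow> (\<Sum>i\<in>I. d i x)"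
    proof (rule AE_I2)
      fix x
      have "(\<lambda>n. \<Sum>i\<in>I. D n i x) \<longlonglongrightarrow> (\<Sum>i\<in>I. 0 * w i x + 1 * d i x)"
        unfolding D_def by (intro tendsto_intros cutoff_tendsto_one cutoff_deriv_tendsto_zero)
      then show "(\<lambda>n. \<Sum>i\<in>I. D n i x) \<longlonglongrightarrow> (\<Sum>i\<in>I. d i x)" by simp
    qed
    show "AE x in lborel. norm (\<Sum>i\<in>I. D n i x)
        \<le> (\<Sum>i\<in>I. 4 * norm (e i) * \<bar>w i x\<bar>) + \<bar>\<Sum>i\<in>I. d i x\<bar>" for n
    proof (rule AE_I2)
      fix x
      have "\<bar>cutoff_deriv (real (Suc n)) (e i) x\<bar> \<le> 4 * norm (e i)" for i
      proof -
        have "4 * norm (e i) / real (Suc n) \<le> 4 * norm (e i)"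
          by (simp add: divide_le_eq mult_left_mono[of 1 "real (Suc n)" "4 * norm (e i)", simplified])
        then show ?thesis
          using abs_cutoff_deriv_le[of "real (Suc n)" "e i" x] by simp
      qed
      then have "\<bar>\<Sum>i\<in>I. cutoff_deriv (real (Suc n)) (e i) x * w i x\<bar>
          \<le> (\<Sum>i\<in>I. 4 * norm (e i) * \<bar>w i x\<bar>)"
        by (intro order_trans[OF sum_abs] sum_mono) (simp add: abs_mult mult_right_mono)
      moreover have "\<bar>cutoff (real (Suc n)) x * (\<Sum>i\<in>I. d i x)\<bar> \<le> \<bar>\<Sum>i\<in>I. d i x\<bar>"
        using cutoff_nonneg_le_one[of "real (Suc n)" x]
        by (simp add: abs_mult mult_left_le_one_le del: of_nat_Suc)
      moreover have "(\<Sum>i\<in>I. D n i x) = (\<Sum>i\<in>I. cutoff_deriv (real (Suc n)) (e i) x * w i x)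
          + cutoff (real (Suc n)) x * (\<Sum>i\<in>I. d i x)"
        by (simp add: D_def sum.distrib sum_distrib_left)
      ultimately show "norm (\<Sum>i\<in>I. D n i x)
          \<le> (\<Sum>i\<in>I. 4 * norm (e i) * \<bar>w i x\<bar>) + \<bar>\<Sum>i\<in>I. d i x\<bar>"
        by simp
    qed
    show "(\<lambda>x. \<Sum>i\<in>I. D n i x) \<in> borel_measurable lborel" for n
      using intD by (intro borel_measurable_sum borel_measurable_integrable)
    show "(\<lambda>x. \<Sum>i\<in>I. d i x) \<in> borel_measurable lborel"
      using int_div by (rule borel_measurable_integrable)
  qed
  then show ?thesis
    by (simp add: zero LIMSEQ_const_iff)
qed

text \<open>The unweighted theorem for the field \<open>exp (- \<psi>) * w\<close>: differentiating
  the weight produces the flux \<open>w i * p i\<close> with a minus sign.\<close>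

lemma weighted_integral_divergence:
  fixes w :: "'i \<Rightarrow> 'a::euclidean_space \<Rightarrow> real" and \<psi> :: "'a \<Rightarrow> real"
  defines "\<nu> \<equiv> density lborel (\<lambda>x. ennreal (exp (- \<psi> x)))"
  assumes "finite I"
    and cont_\<psi>: "continuous_on UNIV \<psi>"
    and cont: "\<And>i. i \<in> I \<Longrightarrow> continuous_on UNIV (w i)" "\<And>i. i \<in> I \<Longrightarrow> continuous_on UNIV (d i)"
      "\<And>i. i \<in> I \<Longrightarrow> continuous_on UNIV (p i)"
    and deriv: "\<And>i. i \<in> I \<Longrightarrow> has_dir_deriv (w i) (e i) (d i)"
      "\<And>i. i \<in> I \<Longrightarrow> has_dir_deriv \<psi> (e i) (p i)"
    and int_w: "\<And>i. i \<in> I \<Longrightarrow> integrable \<nu> (w i)"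
    and int_div: "integrable \<nu> (\<lambda>x. \<Sum>i\<in>I. d i x)"
    and int_wp: "integrable \<nu> (\<lambda>x. \<Sum>i\<in>I. w i x * p i x)"
  shows "(\<integral>x. (\<Sum>i\<in>I. d i x) \<partial>\<nu>) = (\<integral>x. (\<Sum>i\<in>I. w i x * p i x) \<partial>\<nu>)"
proof -
  have [measurable]: "\<psi> \<in> borel_measurable borel"
    using cont_\<psi> by (rule borel_measurable_continuous_onI)
  have transfer: "integrable \<nu> g \<longleftrightarrow> integrable lborel (\<lambda>x. exp (- \<psi> x) * g x)"
      "integral\<^sup>L \<nu> g = (\<integral>x. exp (- \<psi> x) * g x \<partial>lborel)" if "continuous_on UNIV g" for g
    using borel_measurable_continuous_onI[OF that]
    by (auto simp: \<nu>_def integrable_density integral_density)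
  define D where "D i x = (- exp (- \<psi> x) * p i x) * w i x + exp (- \<psi> x) * d i x" for i x
  have exp_deriv: "has_dir_deriv (\<lambda>x. exp (- \<psi> x)) (e i) (\<lambda>x. - exp (- \<psi> x) * p i x)"
    if "i \<in> I" for i
    by (rule has_dir_deriv_compose[OF deriv(2)[OF that], of "\<lambda>y. exp (- y)"])
      (auto intro!: derivative_eq_intros)
  have D: "has_dir_deriv (\<lambda>x. exp (- \<psi> x) * w i x) (e i) (D i)" if "i \<in> I" for i
    unfolding D_def[abs_def] by (intro has_dir_deriv_mult exp_deriv deriv that)
  \<comment> \<open>With the weight factored out, integrability of the Lebesgue divergence reduces
    to that of divergence minus flux under \<open>\<nu>\<close>.\<close>
  have sumD: "(\<Sum>i\<in>I. D i x) = exp (- \<psi> x) * ((\<Sum>i\<in>I. d i x) - (\<Sum>i\<in>I. w i x * p i x))" for x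
    by (simp add: D_def sum_distrib_left right_diff_distrib sum_subtractf[symmetric] algebra_simps)
  have contD: "continuous_on UNIV (\<lambda>x. (\<Sum>i\<in>I. d i x) - (\<Sum>i\<in>I. w i x * p i x))"
    by (intro continuous_intros cont)
  have "(\<integral>x. (\<Sum>i\<in>I. D i x) \<partial>lborel) = 0"
  proof (rule integral_divergence_eq_zero[OF \<open>finite I\<close> _ _ D])
    show "continuous_on UNIV (\<lambda>x. exp (- \<psi> x) * w i x)" "continuous_on UNIV (D i)" if "i \<in> I" for i
      unfolding D_def[abs_def] by (intro continuous_intros cont cont_\<psi> that)+
    show "integrable lborel (\<lambda>x. exp (- \<psi> x) * w i x)" if "i \<in> I" for i
      using int_w[OF that] transfer(1)[OF cont(1)[OF that]] by simp
    show "integrable lborel (\<lambda>x. \<Sum>i\<in>I. D i x)"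
      unfolding sumD transfer(1)[OF contD, symmetric]
      by (intro Bochner_Integration.integrable_diff int_div int_wp)
  qed
  then have "(\<integral>x. (\<Sum>i\<in>I. d i x) - (\<Sum>i\<in>I. w i x * p i x) \<partial>\<nu>) = 0"
    unfolding sumD transfer(2)[OF contD] .
  then show ?thesis
    using int_div int_wp by simp
qed

section \<open>Essentially bounded and square integrable functions\<close>

text \<open>The bound holds almost everywhere because the bound on the gradient of
  \<open>\<psi>\<close> is read off from its law.\<close>

definition ess_bounded :: "'a measure \<Rightarrow> ('a \<Rightarrow> real) \<Rightarrow> bool"
  where "ess_bounded M g \<longleftrightarrow> g \<in> borel_measurable M \<and> (\<exists>C. AE x in M. \<bar>g x\<bar> \<le> C)"

definition square_integrable :: "'a measure \<Rightarrow> ('a \<Rightarrow> real) \<Rightarrow> bool"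
  where "square_integrable M g \<longleftrightarrow> g \<in> borel_measurable M \<and> integrable M (\<lambda>x. (g x)\<^sup>2)"

lemma square_integrable_mult_integrable:
  assumes "square_integrable M g" "square_integrable M h"
  shows "integrable M (\<lambda>x. g x * h x)"
proof (rule Bochner_Integration.integrable_bound)
  show "integrable M (\<lambda>x. (g x)\<^sup>2 + (h x)\<^sup>2)"
    using assms by (auto simp: square_integrable_def)
  show "AE x in M. norm (g x * h x) \<le> norm ((g x)\<^sup>2 + (h x)\<^sup>2)"
  proof (rule AE_I2)
    fix x
    have "2 * (\<bar>g x\<bar> * \<bar>h x\<bar>) \<le> (g x)\<^sup>2 + (h x)\<^sup>2"
      using sum_squares_bound[of "\<bar>g x\<bar>" "\<bar>h x\<bar>"] by simp
    moreover have "0 \<le> \<bar>g x\<bar> * \<bar>h x\<bar>" by simp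
    ultimately show "norm (g x * h x) \<le> norm ((g x)\<^sup>2 + (h x)\<^sup>2)"
      unfolding real_norm_def abs_mult by linarith
  qed
qed (use assms in \<open>auto simp: square_integrable_def\<close>)

lemma square_integrable_add:
  assumes "square_integrable M g" "square_integrable M h"
  shows "square_integrable M (\<lambda>x. g x + h x)"
  using assms square_integrable_mult_integrable[OF assms]
  by (auto simp: square_integrable_def power2_sum mult.assoc)

lemma square_integrable_sum:
  assumes "\<And>i. i \<in> I \<Longrightarrow> square_integrable M (g i)"
  shows "square_integrable M (\<lambda>x. \<Sum>i\<in>I. g i x)"
proof (cases "finite I")
  case True
  then show ?thesis
    using assms by (induction I) (auto simp: square_integrable_add, simp add: square_integrable_def)
qed (simp add: square_integrable_def)

lemma square_integrable_bounded_mult: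
  assumes "ess_bounded M g" "square_integrable M h"
  shows "square_integrable M (\<lambda>x. g x * h x)"
proof -
  obtain C where C: "AE x in M. \<bar>g x\<bar> \<le> C"
    using assms by (auto simp: ess_bounded_def)
  have meas: "g \<in> borel_measurable M" "h \<in> borel_measurable M"
    using assms by (auto simp: ess_bounded_def square_integrable_def)
  have "integrable M (\<lambda>x. (g x * h x)\<^sup>2)"
  proof (rule Bochner_Integration.integrable_bound)
    show "integrable M (\<lambda>x. C\<^sup>2 * (h x)\<^sup>2)"
      using assms by (auto simp: square_integrable_def)
    show "AE x in M. norm ((g x * h x)\<^sup>2) \<le> norm (C\<^sup>2 * (h x)\<^sup>2)"
      using C
    proof eventually_elim
      case (elim x)
      then have "(g x)\<^sup>2 \<le> C\<^sup>2"
        using abs_le_square_iff[of "g x" C] by simp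
      then show ?case
        by (simp add: power_mult_distrib mult_right_mono)
    qed
  qed (use meas in measurable)
  with meas show ?thesis
    by (simp add: square_integrable_def)
qed

lemma ess_bounded_const: "ess_bounded M (\<lambda>x. c)"
  by (auto simp: ess_bounded_def)

lemma ess_bounded_mult:
  assumes "ess_bounded M g" "ess_bounded M h"
  shows "ess_bounded M (\<lambda>x. g x * h x)"
proof -
  obtain C D where "AE x in M. \<bar>g x\<bar> \<le> C" "AE x in M. \<bar>h x\<bar> \<le> D"
    using assms by (auto simp: ess_bounded_def)
  then have "AE x in M. \<bar>g x * h x\<bar> \<le> C * D"
    by eventually_elim (auto simp: abs_mult intro!: mult_mono)
  then show ?thesis
    using assms by (auto simp: ess_bounded_def)
qed

lemma ess_bounded_add:
  assumes "ess_bounded M g" "ess_bounded M h"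
  shows "ess_bounded M (\<lambda>x. g x + h x)"
proof -
  obtain C D where "AE x in M. \<bar>g x\<bar> \<le> C" "AE x in M. \<bar>h x\<bar> \<le> D"
    using assms by (auto simp: ess_bounded_def)
  then have "AE x in M. \<bar>g x + h x\<bar> \<le> C + D"
    by eventually_elim linarith
  then show ?thesis
    using assms by (auto simp: ess_bounded_def)
qed

lemma ess_bounded_sum:
  assumes "\<And>i. i \<in> I \<Longrightarrow> ess_bounded M (g i)"
  shows "ess_bounded M (\<lambda>x. \<Sum>i\<in>I. g i x)"
proof (cases "finite I")
  case True
  then show ?thesis
    using assms by (induction I) (auto simp: ess_bounded_add ess_bounded_const)
qed (simp add: ess_bounded_const)

lemma (in finite_measure) square_integrable_const: "square_integrable M (\<lambda>x. c)"
  by (simp add: square_integrable_def)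

lemma (in finite_measure) square_integrable_ess_bounded:
  "ess_bounded M g \<Longrightarrow> square_integrable M g"
  using square_integrable_bounded_mult[OF _ square_integrable_const, of g 1] by simp

lemma (in finite_measure) square_integrable_imp_integrable:
  "square_integrable M g \<Longrightarrow> integrable M g"
  using square_integrable_mult_integrable[OF _ square_integrable_const, of g 1] by simp

section \<open>Variance identities for moment measures\<close>

text \<open>Symmetry turns each product of opposite entries into a square, so the trace is the
  squared Frobenius norm. It then dominates the square of every single entry, which makes the
  entries of the Hessian square integrable.\<close>

lemma trace_mult_self_symmetric:
  fixes H :: "real^'n^'n"
  assumes "\<And>i j. H $ i $ j = H $ j $ i"
  shows "trace (H ** H) = (\<Sum>i\<in>UNIV. \<Sum>j\<in>UNIV. (H $ i $ j)\<^sup>2)"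
  unfolding trace_def matrix_matrix_mult_def power2_eq_square
proof -
  have "H $ i $ j * H $ j $ i = H $ i $ j * H $ i $ j" for i j
    using assms[of i j] by simp
  then show "(\<Sum>i\<in>UNIV. (\<chi> i j. \<Sum>k\<in>UNIV. H $ i $ k * H $ k $ j) $ i $ i)
      = (\<Sum>i\<in>UNIV. \<Sum>j\<in>UNIV. H $ i $ j * H $ i $ j)"
    by (simp only: vec_lambda_beta)
qed

text \<open>Gradient, Hessian and third derivatives enter as component functions \<open>Y\<close>,
  \<open>H\<close> and \<open>D\<close>, which reduces the argument to calculus in coordinates. The
  integrability claims serve the variance formula and the change of variables; the equality of means
  lets the squared means cancel in the difference of the variances.\<close>

lemma moment_measure_identities:
  fixes \<psi> :: "real^'n \<Rightarrow> real" and Y :: "real^'n \<Rightarrow> real^'n" and H :: "real^'n \<Rightarrow> real^'n^'n"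
    and D :: "'n \<Rightarrow> 'n \<Rightarrow> 'n \<Rightarrow> real^'n \<Rightarrow> real" and A :: "real^'n^'n"
  defines "\<nu> \<equiv> density lborel (\<lambda>x. ennreal (exp (- \<psi> x)))"
  defines "f \<equiv> \<lambda>x. trace (A ** H x)"
    and "q \<equiv> \<lambda>x. Y x \<bullet> (A *v Y x)"
    and "T \<equiv> \<lambda>x. (A *v Y x) \<bullet> (H x *v (A *v Y x))"
    and "S \<equiv> \<lambda>x. trace (A ** H x ** A ** H x)"
  assumes fin: "finite_measure \<nu>"
    and cont: "continuous_on UNIV \<psi>" "\<And>i. continuous_on UNIV (\<lambda>x. Y x $ i)"
      "\<And>i j. continuous_on UNIV (\<lambda>x. H x $ i $ j)" "\<And>i j k. continuous_on UNIV (D i j k)"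
    and d\<psi>: "\<And>i. has_dir_deriv \<psi> (axis i 1) (\<lambda>x. Y x $ i)"
    and dY: "\<And>i j. has_dir_deriv (\<lambda>x. Y x $ i) (axis j 1) (\<lambda>x. H x $ i $ j)"
    and dH: "\<And>i j k. has_dir_deriv (\<lambda>x. H x $ i $ j) (axis k 1) (D i j k)"
    and bound: "AE x in \<nu>. norm (Y x) \<le> B"
    and int_H: "integrable \<nu> (\<lambda>x. trace (H x ** H x))"
    and A: "transpose A = A"
  shows "integrable \<nu> f" "integrable \<nu> (\<lambda>x. (f x)\<^sup>2)" "integrable \<nu> q"
    "integrable \<nu> (\<lambda>x. (q x)\<^sup>2)" "integrable \<nu> T" "integrable \<nu> S"
    and "integral\<^sup>L \<nu> f = integral\<^sup>L \<nu> q"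
    and "(\<integral>x. (f x)\<^sup>2 \<partial>\<nu>) = (\<integral>x. (q x)\<^sup>2 \<partial>\<nu>) - 3 * integral\<^sup>L \<nu> T + integral\<^sup>L \<nu> S"
proof -
  interpret finite_measure \<nu> by (rule fin)

  \<comment> \<open>Symmetry of \<open>A\<close> and of the derivatives of
    \<open>\<psi>\<close>\<close>
  have A_sym: "A $ i $ j = A $ j $ i" for i j
    using arg_cong[OF A, of "\<lambda>M. M $ j $ i"] by (simp add: transpose_def)
  have H_sym: "H x $ i $ j = H x $ j $ i" for x i j
    using mixed_dir_derivs_commute[OF d\<psi>[of i] dY[of i j] cont(3) d\<psi>[of j] dY[of j i] cont(3)] .
  \<comment> \<open>The last two indices of \<open>D\<close> are both differentiations of the
    component \<open>Y x $ i\<close>, so they commute.\<close>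
  have D_sym: "D i j k x = D i k j x" for x i j k
    using mixed_dir_derivs_commute[OF dY[of i j] dH[of i j k] cont(4) dY[of i k] dH[of i k j] cont(4)] .
  have meas: "g \<in> borel_measurable \<nu>" if "continuous_on UNIV g" for g :: "real^'n \<Rightarrow> real"
    using borel_measurable_continuous_onI[OF that] by (simp add: \<nu>_def)

  \<comment> \<open>Components of \<open>A Y\<close>, \<open>A H\<close> and \<open>H A Y\<close>:
    the functions \<open>v\<close>, \<open>dv\<close> and \<open>Hv\<close>\<close>
  define v where "v i x = (\<Sum>j\<in>UNIV. A $ i $ j * Y x $ j)" for i x
  define dv where "dv i j x = (\<Sum>k\<in>UNIV. A $ i $ k * H x $ k $ j)" for i j x
  define Hv where "Hv i x = (\<Sum>j\<in>UNIV. H x $ i $ j * v j x)" for i x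
  have v_eq: "(A *v Y x) $ i = v i x" for i x
    by (simp add: v_def matrix_vector_mult_def)
  have f_eq: "f x = (\<Sum>i\<in>UNIV. dv i i x)" for x
    by (simp add: f_def dv_def trace_def matrix_matrix_mult_def)
  have q_eq: "q x = (\<Sum>i\<in>UNIV. v i x * Y x $ i)" for x
    by (simp add: q_def inner_vec_def v_eq mult.commute)
  have T_eq: "T x = (\<Sum>i\<in>UNIV. v i x * Hv i x)" for x
  proof -
    have "(H x *v (A *v Y x)) $ i = Hv i x" for i
      by (subst matrix_vector_mult_def) (simp add: Hv_def v_eq)
    then show ?thesis
      by (simp add: T_def inner_vec_def v_eq)
  qed
  \<comment> \<open>The product is bracketed from the right so that its trace takes the shape of the
    part of the divergence of \<open>A H A Y\<close> in which \<open>A Y\<close> is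
    differentiated.\<close>
  have S_eq: "S x = (\<Sum>i\<in>UNIV. \<Sum>k\<in>UNIV. A $ i $ k * (\<Sum>m\<in>UNIV. H x $ k $ m * dv m i x))" for x
  proof -
    have "A ** H x ** A ** H x = A ** (H x ** (A ** H x))"
      by (simp only: matrix_mul_assoc)
    then show ?thesis
      unfolding S_def by (simp only:) (simp add: trace_def matrix_matrix_mult_def dv_def)
  qed
  \<comment> \<open>The transpose of \<open>A H\<close> is \<open>H A\<close>, because both matrices
    are symmetric.\<close>
  have dvY: "(\<Sum>k\<in>UNIV. dv k i x * Y x $ k) = Hv i x" for i x
  proof -
    have "(\<Sum>k\<in>UNIV. dv k i x * Y x $ k)
        = (\<Sum>k\<in>UNIV. \<Sum>m\<in>UNIV. H x $ i $ m * (A $ m $ k * Y x $ k))"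
      unfolding dv_def sum_distrib_right
      by (intro sum.cong refl) (metis A_sym H_sym mult.assoc mult.commute)
    also have "\<dots> = Hv i x"
      unfolding Hv_def v_def sum_distrib_left by (rule sum.swap)
    finally show ?thesis .
  qed

  \<comment> \<open>Continuity and derivatives of the components\<close>
  have contv: "continuous_on UNIV (v i)" for i
    unfolding v_def[abs_def] by (intro continuous_intros cont)
  have contdv: "continuous_on UNIV (dv i j)" for i j
    unfolding dv_def[abs_def] by (intro continuous_intros cont)
  have contHv: "continuous_on UNIV (Hv i)" for i
    unfolding Hv_def[abs_def] by (intro continuous_intros cont contv)
  have contq: "continuous_on UNIV q"
    unfolding q_eq[abs_def] by (intro continuous_intros cont contv)
  have contf: "continuous_on UNIV f"
    unfolding f_eq[abs_def] by (intro continuous_intros contdv)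
  have ders_v: "has_dir_deriv (v i) (axis j 1) (dv i j)" for i j
    unfolding v_def[abs_def] dv_def[abs_def] by (intro has_dir_deriv_sum has_dir_deriv_cmult dY)

  \<comment> \<open>Integrability from bounded \<open>Y\<close> and square integrable
    \<open>H\<close>\<close>
  have bY: "ess_bounded \<nu> (\<lambda>x. Y x $ i)" for i
  proof -
    have "AE x in \<nu>. \<bar>Y x $ i\<bar> \<le> B"
      using bound by eventually_elim (use component_le_norm_cart order_trans in blast)
    then show ?thesis
      using meas[OF cont(2)] by (auto simp: ess_bounded_def)
  qed
  have bv: "ess_bounded \<nu> (v i)" for i
    unfolding v_def[abs_def] by (intro ess_bounded_sum ess_bounded_mult ess_bounded_const bY)
  have bq: "ess_bounded \<nu> q"
    unfolding q_eq[abs_def] by (intro ess_bounded_sum ess_bounded_mult bv bY)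
  have sH: "square_integrable \<nu> (\<lambda>x. H x $ i $ j)" for i j
  proof -
    have "integrable \<nu> (\<lambda>x. (H x $ i $ j)\<^sup>2)"
    proof (rule Bochner_Integration.integrable_bound[OF int_H])
      show "AE x in \<nu>. norm ((H x $ i $ j)\<^sup>2) \<le> norm (trace (H x ** H x))"
      proof (rule AE_I2)
        fix x
        have "(H x $ i $ j)\<^sup>2 \<le> (\<Sum>j\<in>UNIV. (H x $ i $ j)\<^sup>2)"
          by (rule member_le_sum) auto
        also have "\<dots> \<le> (\<Sum>i\<in>UNIV. \<Sum>j\<in>UNIV. (H x $ i $ j)\<^sup>2)"
          by (rule member_le_sum) (auto intro: sum_nonneg)
        also have "\<dots> = trace (H x ** H x)"
          using trace_mult_self_symmetric[of "H x"] H_sym by metis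
        finally show "norm ((H x $ i $ j)\<^sup>2) \<le> norm (trace (H x ** H x))"
          by simp
      qed
      show "(\<lambda>x. (H x $ i $ j)\<^sup>2) \<in> borel_measurable \<nu>"
        using meas[OF cont(3)] by measurable
    qed
    then show ?thesis
      using meas[OF cont(3)] by (simp add: square_integrable_def)
  qed
  note square_intros = square_integrable_sum square_integrable_bounded_mult[OF ess_bounded_const] sH
  have sv: "square_integrable \<nu> (v i)" for i
    by (rule square_integrable_ess_bounded[OF bv])
  have sq: "square_integrable \<nu> q"
    by (rule square_integrable_ess_bounded[OF bq])
  have sdv: "square_integrable \<nu> (dv i j)" for i j
    unfolding dv_def[abs_def] by (intro square_intros)
  have sf: "square_integrable \<nu> f"
    unfolding f_eq[abs_def] by (intro square_integrable_sum sdv)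
  have sHv: "square_integrable \<nu> (Hv i)" for i
  proof -
    have "square_integrable \<nu> (\<lambda>x. \<Sum>j\<in>UNIV. v j x * H x $ i $ j)"
      by (intro square_integrable_sum square_integrable_bounded_mult bv sH)
    then show ?thesis
      by (simp add: Hv_def[abs_def] mult.commute)
  qed
  show int_f: "integrable \<nu> f" and int_q: "integrable \<nu> q"
    by (intro square_integrable_imp_integrable sf sq)+
  show int_f2: "integrable \<nu> (\<lambda>x. (f x)\<^sup>2)" and int_q2: "integrable \<nu> (\<lambda>x. (q x)\<^sup>2)"
    using sf sq by (auto simp: square_integrable_def)
  show int_T: "integrable \<nu> T"
    unfolding T_eq[abs_def]
    by (intro Bochner_Integration.integrable_sum square_integrable_mult_integrable sv sHv)
  show int_S: "integrable \<nu> S"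
    unfolding S_eq[abs_def]
    by (intro Bochner_Integration.integrable_sum integrable_mult_right square_integrable_mult_integrable sH sdv)
  have int_qf: "integrable \<nu> (\<lambda>x. q x * f x)"
    by (intro square_integrable_mult_integrable sf sq)

  \<comment> \<open>The three divergence identities\<close>
  note parts = weighted_integral_divergence[where I = UNIV and p = "\<lambda>i x. Y x $ i" and \<psi> = \<psi>
      and e = "\<lambda>i. axis i 1", folded \<nu>_def, OF finite_class.finite_UNIV cont(1) _ _ cont(2) _ d\<psi>]

  show f_q: "integral\<^sup>L \<nu> f = integral\<^sup>L \<nu> q"
    unfolding f_eq[abs_def] q_eq[abs_def]
    by (rule parts[OF contv contdv ders_v])
      (use square_integrable_imp_integrable[OF sv] int_f int_q in \<open>simp_all add: f_eq[abs_def] q_eq[abs_def]\<close>)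

  define d2 where "d2 i x = 2 * Hv i x * v i x + q x * dv i i x" for i x
  \<comment> \<open>The gradient of \<open>q\<close> is \<open>2 H A Y\<close>: the two halves of
    the product rule coincide by symmetry of \<open>A\<close> and \<open>H\<close>. Pairing it with
    \<open>A Y\<close> gives the term \<open>2 T\<close> in the divergence of
    \<open>q A Y\<close>.\<close>
  have dq: "has_dir_deriv q (axis i 1) (\<lambda>x. 2 * Hv i x)" for i
  proof -
    have "has_dir_deriv q (axis i 1) (\<lambda>x. \<Sum>k\<in>UNIV. dv k i x * Y x $ k + v k x * H x $ k $ i)"
      unfolding q_eq[abs_def] by (intro has_dir_deriv_sum has_dir_deriv_mult ders_v dY)
    moreover have "(\<Sum>k\<in>UNIV. dv k i x * Y x $ k + v k x * H x $ k $ i) = 2 * Hv i x" for x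
    proof -
      have "(\<Sum>k\<in>UNIV. v k x * H x $ k $ i) = Hv i x"
        unfolding Hv_def by (intro sum.cong refl) (metis H_sym mult.commute)
      then show ?thesis
        by (simp add: sum.distrib dvY)
    qed
    ultimately show ?thesis by simp
  qed
  have div2: "(\<Sum>i\<in>UNIV. d2 i x) = 2 * T x + q x * f x" for x
    by (simp add: d2_def T_eq f_eq sum.distrib sum_distrib_left mult.commute mult.left_commute)
  have flux2: "(\<Sum>i\<in>UNIV. q x * v i x * Y x $ i) = (q x)\<^sup>2" for x
    by (simp add: q_eq power2_eq_square sum_distrib_left mult.assoc)
  have "(\<integral>x. (\<Sum>i\<in>UNIV. d2 i x) \<partial>\<nu>) = (\<integral>x. (\<Sum>i\<in>UNIV. q x * v i x * Y x $ i) \<partial>\<nu>)"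
  proof (rule parts)
    show "continuous_on UNIV (\<lambda>x. q x * v i x)" "continuous_on UNIV (d2 i)" for i
      unfolding d2_def[abs_def] by (intro continuous_intros contq contv contHv contdv)+
    show "has_dir_deriv (\<lambda>x. q x * v i x) (axis i 1) (d2 i)" for i
      unfolding d2_def[abs_def] by (intro has_dir_deriv_mult dq ders_v)
    show "integrable \<nu> (\<lambda>x. q x * v i x)" for i
      by (intro square_integrable_mult_integrable sq sv)
    show "integrable \<nu> (\<lambda>x. \<Sum>i\<in>UNIV. d2 i x)" "integrable \<nu> (\<lambda>x. \<Sum>i\<in>UNIV. q x * v i x * Y x $ i)"
      unfolding div2 flux2 using int_T int_qf int_q2 by simp_all
  qed
  then have q2: "2 * integral\<^sup>L \<nu> T + (\<integral>x. q x * f x \<partial>\<nu>) = (\<integral>x. (q x)\<^sup>2 \<partial>\<nu>)"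
    unfolding div2 flux2 using int_T int_qf by simp

  \<comment> \<open>Here \<open>u\<close> collects the components of \<open>A H A Y\<close>,
    \<open>df i\<close> is the derivative of \<open>f\<close> along the axis \<open>i\<close>,
    \<open>du i\<close> that of \<open>u i\<close>, and \<open>d3\<close> sums to the divergence of
    \<open>f A Y - A H A Y\<close>.\<close>
  define u where "u i x = (\<Sum>k\<in>UNIV. A $ i $ k * Hv k x)" for i x
  define df where "df i x = (\<Sum>k\<in>UNIV. \<Sum>m\<in>UNIV. A $ k $ m * D m k i x)" for i x
  define du where "du i x = (\<Sum>k\<in>UNIV. A $ i $ k *
      (\<Sum>m\<in>UNIV. D k m i x * v m x + H x $ k $ m * dv m i x))" for i x
  define d3 where "d3 i x = (df i x * v i x + f x * dv i i x) - du i x" for i x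
  have contu: "continuous_on UNIV (u i)" for i
    unfolding u_def[abs_def] by (intro continuous_intros contHv)
  have su: "square_integrable \<nu> (u i)" for i
    unfolding u_def[abs_def] by (intro square_intros sHv)
  have ders_f: "has_dir_deriv f (axis i 1) (df i)" for i
    unfolding f_eq[abs_def] df_def[abs_def] dv_def[abs_def]
    by (intro has_dir_deriv_sum has_dir_deriv_cmult dH)
  have ders_u: "has_dir_deriv (u i) (axis i 1) (du i)" for i
    unfolding u_def[abs_def] du_def[abs_def] Hv_def[abs_def]
    by (intro has_dir_deriv_sum has_dir_deriv_cmult has_dir_deriv_mult dH ders_v)
  \<comment> \<open>The third derivatives of \<open>\<psi>\<close> cancel, so the divergence is integrable although its
    individual summands need not be.\<close>
  have div3: "(\<Sum>i\<in>UNIV. d3 i x) = (f x)\<^sup>2 - S x" for x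
  proof -
    \<comment> \<open>Exchanging the last two indices of \<open>D\<close> and reordering the sums
      turns the third-order part of the divergence of \<open>u\<close> into the derivative of
      \<open>f\<close> along \<open>A Y\<close>.\<close>
    have "(\<Sum>i\<in>UNIV. \<Sum>k\<in>UNIV. A $ i $ k * (\<Sum>m\<in>UNIV. D k m i x * v m x))
        = (\<Sum>i\<in>UNIV. \<Sum>k\<in>UNIV. \<Sum>m\<in>UNIV. A $ i $ k * D k i m x * v m x)"
      unfolding sum_distrib_left by (intro sum.cong refl) (simp add: D_sym mult.assoc)
    also have "\<dots> = (\<Sum>i\<in>UNIV. \<Sum>m\<in>UNIV. \<Sum>k\<in>UNIV. A $ i $ k * D k i m x * v m x)"
      by (intro sum.cong refl sum.swap)
    also have "\<dots> = (\<Sum>m\<in>UNIV. \<Sum>i\<in>UNIV. \<Sum>k\<in>UNIV. A $ i $ k * D k i m x * v m x)"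
      by (rule sum.swap)
    also have "\<dots> = (\<Sum>m\<in>UNIV. df m x * v m x)"
      by (simp add: df_def sum_distrib_right)
    finally have third: "(\<Sum>i\<in>UNIV. \<Sum>k\<in>UNIV. A $ i $ k * (\<Sum>m\<in>UNIV. D k m i x * v m x))
        = (\<Sum>m\<in>UNIV. df m x * v m x)" .
    have "(\<Sum>i\<in>UNIV. du i x) = (\<Sum>m\<in>UNIV. df m x * v m x) + S x"
      by (simp add: du_def S_eq sum.distrib distrib_left third[symmetric])
    then show ?thesis
      by (simp add: d3_def sum.distrib sum_subtractf f_eq power2_eq_square sum_distrib_left)
  qed
  have flux3: "(\<Sum>i\<in>UNIV. (f x * v i x - u i x) * Y x $ i) = q x * f x - T x" for x
  proof -
    \<comment> \<open>Symmetry of \<open>A\<close> moves the outer factor of \<open>A H A Y\<close>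
      onto \<open>Y\<close>, which leaves the quadratic form of \<open>H\<close> at
      \<open>A Y\<close>.\<close>
    have "(\<Sum>i\<in>UNIV. u i x * Y x $ i)
        = (\<Sum>k\<in>UNIV. \<Sum>i\<in>UNIV. A $ i $ k * Hv k x * Y x $ i)"
      unfolding u_def sum_distrib_right by (rule sum.swap)
    also have "\<dots> = T x"
      unfolding T_eq v_def sum_distrib_right
      by (intro sum.cong refl) (metis A_sym mult.assoc mult.commute)
    finally have uY: "(\<Sum>i\<in>UNIV. u i x * Y x $ i) = T x" .
    have "(\<Sum>i\<in>UNIV. (f x * v i x - u i x) * Y x $ i)
        = f x * q x - (\<Sum>i\<in>UNIV. u i x * Y x $ i)"
      by (simp add: left_diff_distrib sum_subtractf q_eq sum_distrib_left mult.assoc)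
    then show ?thesis
      by (simp add: uY)
  qed
  have "(\<integral>x. (\<Sum>i\<in>UNIV. d3 i x) \<partial>\<nu>) = (\<integral>x. (\<Sum>i\<in>UNIV. (f x * v i x - u i x) * Y x $ i) \<partial>\<nu>)"
  proof (rule parts)
    show "continuous_on UNIV (\<lambda>x. f x * v i x - u i x)" for i
      by (intro continuous_intros contf contv contu)
    show "continuous_on UNIV (d3 i)" for i
      unfolding d3_def[abs_def] df_def[abs_def] du_def[abs_def]
      by (intro continuous_intros cont contf contv contdv)
    show "has_dir_deriv (\<lambda>x. f x * v i x - u i x) (axis i 1) (d3 i)" for i
      unfolding d3_def[abs_def] by (intro has_dir_deriv_diff has_dir_deriv_mult ders_f ders_v ders_u)
    show "integrable \<nu> (\<lambda>x. f x * v i x - u i x)" for i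
      by (intro Bochner_Integration.integrable_diff square_integrable_mult_integrable
          square_integrable_imp_integrable sf sv su)
    show "integrable \<nu> (\<lambda>x. \<Sum>i\<in>UNIV. d3 i x)"
      "integrable \<nu> (\<lambda>x. \<Sum>i\<in>UNIV. (f x * v i x - u i x) * Y x $ i)"
      unfolding div3 flux3 using int_T int_S int_qf int_f2 by simp_all
  qed
  then have "(\<integral>x. (f x)\<^sup>2 \<partial>\<nu>) - integral\<^sup>L \<nu> S = (\<integral>x. q x * f x \<partial>\<nu>) - integral\<^sup>L \<nu> T"
    unfolding div3 flux3 using int_T int_S int_qf int_f2 by simp
  \<comment> \<open>Elimination of the mixed moment of \<open>q\<close> and \<open>f\<close> gives
    the coefficient \<open>3\<close>: two copies of the integral of \<open>T\<close> come from the
    field \<open>q A Y\<close>, one from the last field.\<close>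
  with q2 show "(\<integral>x. (f x)\<^sup>2 \<partial>\<nu>) = (\<integral>x. (q x)\<^sup>2 \<partial>\<nu>) - 3 * integral\<^sup>L \<nu> T + integral\<^sup>L \<nu> S"
    by linarith
qed

section \<open>Derivatives and gradient law of a moment potential\<close>

lemma C_k_on_imp_continuous_on:
  assumes "C_k_on k S f"
  shows "continuous_on S f"
proof (cases k)
  case (Suc m)
  then have "f differentiable (at x)" if "x \<in> S" for x
    using assms that by simp
  then show ?thesis
    by (simp add: continuous_at_imp_continuous_on differentiable_imp_continuous_within)
qed (use assms in simp)

lemma C_k_on_Suc_imp_has_dir_deriv:
  assumes "C_k_on (Suc k) UNIV f"
  shows "has_dir_deriv f v (\<lambda>x. frechet_derivative f (at x) v)"
  by (rule has_derivative_imp_has_dir_deriv)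
    (use assms in \<open>simp add: frechet_derivative_works[symmetric]\<close>)

text \<open>A vector-valued map is differentiated componentwise, so the Jacobian of the gradient
  consists of the iterated directional derivatives that \<open>C_k_on\<close> controls.\<close>

lemma hessian_component:
  assumes "C_k_on 2 UNIV \<psi>"
  shows "hessian \<psi> x $ i $ j
    = frechet_derivative (\<lambda>x. frechet_derivative \<psi> (at x) (axis i 1)) (at x) (axis j 1)"
proof -
  let ?G = "\<lambda>i x. frechet_derivative \<psi> (at x) (axis i 1)"
  have "(?G i has_derivative frechet_derivative (?G i) (at x)) (at x)" for i
    using assms by (simp add: numeral_2_eq_2 frechet_derivative_works[symmetric])
  then have "((\<lambda>x. \<chi> i. ?G i x) has_derivative (\<lambda>h. \<chi> i. frechet_derivative (?G i) (at x) h)) (at x)"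
    by (subst has_derivative_componentwise_within)
      (auto simp: Basis_vec_def cart_eq_inner_axis[symmetric])
  then have "frechet_derivative (gradient \<psi>) (at x) = (\<lambda>h. \<chi> i. frechet_derivative (?G i) (at x) h)"
    unfolding gradient_def[abs_def] by (rule frechet_derivative_at[symmetric])
  then show ?thesis
    by (simp add: hessian_def jacobian_def matrix_def)
qed

text \<open>The law of the gradient is \<open>\<mu>\<close>, which is concentrated on the bounded
  set \<open>K\<close>; pulling this back gives the almost sure bound on \<open>Y\<close>.\<close>

lemma moment_potential_AE_bounded_gradient:
  fixes \<psi> :: "real^'n \<Rightarrow> real"
  assumes "regular_isotropic_log_concave \<mu>" "moment_potential \<mu> \<psi>"
    and meas[measurable]: "gradient \<psi> \<in> borel_measurable borel"
  obtains B where "AE x in density lborel (\<lambda>u. ennreal (exp (- \<psi> u))). norm (gradient \<psi> x) \<le> B"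
proof -
  obtain K V W where K: "bounded K" "open K" "closure K \<subseteq> W" "smooth_on W V"
    and \<mu>: "\<mu> = density lborel (\<lambda>y. ennreal (exp (- V y) * indicator K y))"
    using assms(1) by (auto simp: regular_isotropic_log_concave_def)
  obtain B where B: "\<And>y. y \<in> K \<Longrightarrow> norm y \<le> B"
    using \<open>bounded K\<close> by (auto simp: bounded_iff)
  have "C_k_on 0 W V"
    using K(4) by (simp add: smooth_on_def del: C_k_on.simps)
  then have "continuous_on K V"
    using K(3) closure_subset[of K] by (auto intro: continuous_on_subset)
  \<comment> \<open>Regularity of \<open>V\<close> is known only on \<open>W\<close>, so
    measurability of the density on the whole space comes from continuity on the open set
    \<open>K\<close> and the indicator.\<close>
  then have "(\<lambda>y. indicator K y *\<^sub>R exp (- V y)) \<in> borel_measurable borel"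
    using \<open>open K\<close> by (intro borel_measurable_continuous_on_indicator continuous_intros) auto
  then have "(\<lambda>y. ennreal (exp (- V y) * indicator K y)) \<in> borel_measurable lborel"
    by (simp add: mult.commute)
  then have "AE y in \<mu>. y \<in> K"
    unfolding \<mu> by (subst AE_density) (auto intro!: AE_I2 split: split_indicator_asm)
  moreover have distr: "distr (density lborel (\<lambda>u. ennreal (exp (- \<psi> u)))) borel (gradient \<psi>) = \<mu>"
    using assms(2) by (simp add: moment_potential_def)
  ultimately have "AE y in distr (density lborel (\<lambda>u. ennreal (exp (- \<psi> u)))) borel (gradient \<psi>). y \<in> K"
    unfolding distr by blast
  then have "AE x in density lborel (\<lambda>u. ennreal (exp (- \<psi> u))). gradient \<psi> x \<in> K"
    using \<open>open K\<close> by (subst (asm) AE_distr_iff) auto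
  then have "AE x in density lborel (\<lambda>u. ennreal (exp (- \<psi> u))). norm (gradient \<psi> x) \<le> B"
    by eventually_elim (rule B)
  then show ?thesis by (rule that)
qed

theorem lemma3p1:
  fixes \<mu> :: "(real^'n) measure"
    and \<psi> :: "real^'n \<Rightarrow> real"
    and M :: "'a measure"
    and U Y :: "'a \<Rightarrow> real^'n"
    and H :: "'a \<Rightarrow> real^'n^'n"
    and A :: "real^'n^'n"
    and f q :: "'a \<Rightarrow> real"
    and T_A U_A :: real
  assumes "regular_isotropic_log_concave \<mu>"
    and "moment_potential \<mu> \<psi>"
    and "prob_space M"
    and "distributed M lborel U (\<lambda>u. ennreal (exp (- \<psi> u)))"
    and Y: "Y = (\<lambda>\<omega>. gradient \<psi> (U \<omega>))"
    and H: "H = (\<lambda>\<omega>. hessian \<psi> (U \<omega>))"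
    and "integrable M (\<lambda>\<omega>. trace (H \<omega> ** H \<omega>))"
    and "transpose A = A"
    and f: "f = (\<lambda>\<omega>. trace (A ** H \<omega>))"
    and q: "q = (\<lambda>\<omega>. Y \<omega> \<bullet> (A *v Y \<omega>))"
    and T_A: "T_A = prob_space.expectation M (\<lambda>\<omega>. (A *v Y \<omega>) \<bullet> (H \<omega> *v (A *v Y \<omega>)))"
    and U_A: "U_A = prob_space.expectation M (\<lambda>\<omega>. trace (A ** H \<omega> ** A ** H \<omega>))"
  shows "integrable M (\<lambda>\<omega>. (f \<omega>)\<^sup>2) \<and>
    integrable M (\<lambda>\<omega>. (q \<omega>)\<^sup>2) \<and>
    integrable M (\<lambda>\<omega>. (A *v Y \<omega>) \<bullet> (H \<omega> *v (A *v Y \<omega>))) \<and>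
    integrable M (\<lambda>\<omega>. trace (A ** H \<omega> ** A ** H \<omega>)) \<and>
    prob_space.variance M f = prob_space.variance M q - 3 * T_A + U_A"
proof -
  interpret prob_space M by fact
  define \<nu> where "\<nu> = density lborel (\<lambda>u. ennreal (exp (- \<psi> u)))"
  define f' where "f' x = trace (A ** hessian \<psi> x)" for x
  define q' where "q' x = gradient \<psi> x \<bullet> (A *v gradient \<psi> x)" for x
  define T where "T x = (A *v gradient \<psi> x) \<bullet> (hessian \<psi> x *v (A *v gradient \<psi> x))" for x
  define S where "S x = trace (A ** hessian \<psi> x ** A ** hessian \<psi> x)" for x
  have U[measurable]: "U \<in> borel_measurable M"
    using assms(4) distributed_measurable by fastforce
  have \<nu>: "\<nu> = distr M lborel U"
    \<comment> \<open>With \<open>\<nu>\<close> identified as the law of \<open>U\<close>, every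
      expectation over \<open>M\<close> becomes an integral over the Euclidean space.\<close>
    unfolding \<nu>_def using assms(4) by (rule distributed_distr_eq_density[symmetric])
  interpret \<nu>: prob_space \<nu>
    unfolding \<nu> by (rule prob_space_distr) simp

  let ?G = "\<lambda>i x. frechet_derivative \<psi> (at x) (axis i 1)"
  let ?h = "\<lambda>i j x. frechet_derivative (?G i) (at x) (axis j 1)"
  \<comment> \<open>Three orders of smoothness are extracted: the fields contain second derivatives,
    and their divergences contain third derivatives, which have to be continuous.\<close>
  have C3: "C_k_on (Suc (Suc (Suc 0))) UNIV \<psi>"
    using assms(2) by (simp add: moment_potential_def smooth_on_def del: C_k_on.simps)
  then have C2: "C_k_on (Suc (Suc 0)) UNIV (?G i)" for i
    by (subst (asm) C_k_on.simps) blast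
  then have C1: "C_k_on (Suc 0) UNIV (?h i j)" for i j
    by (subst (asm) C_k_on.simps) blast
  then have C0: "C_k_on 0 UNIV (\<lambda>x. frechet_derivative (?h i j) (at x) (axis k 1))" for i j k
    by (subst (asm) C_k_on.simps) blast
  have "C_k_on 2 UNIV \<psi>"
    using assms(2) by (simp add: moment_potential_def smooth_on_def del: C_k_on.simps)
  note h_eq = hessian_component[OF this]
  have g_eq: "gradient \<psi> x $ i = ?G i x" for x i
    by (simp add: gradient_def)
  have cont_g: "continuous_on UNIV (\<lambda>x. gradient \<psi> x $ i)"
    and cont_h: "continuous_on UNIV (\<lambda>x. hessian \<psi> x $ i $ j)" for i j
    unfolding g_eq h_eq using C_k_on_imp_continuous_on C2 C1 by blast+
  have meas_g[measurable]: "gradient \<psi> \<in> borel_measurable borel"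
    using continuous_on_vec_lambda[of UNIV "\<lambda>i x. gradient \<psi> x $ i", OF cont_g]
    by (simp add: borel_measurable_continuous_onI)
  obtain B where B: "AE x in \<nu>. norm (gradient \<psi> x) \<le> B"
    unfolding \<nu>_def using moment_potential_AE_bounded_gradient[OF assms(1,2) meas_g] by blast
  have cont_trace: "continuous_on UNIV (\<lambda>x. trace (hessian \<psi> x ** hessian \<psi> x))"
    unfolding trace_def matrix_matrix_mult_def by (simp, intro continuous_intros cont_h)
  have "integrable \<nu> (\<lambda>x. trace (hessian \<psi> x ** hessian \<psi> x))"
    unfolding \<nu> using assms(7) H borel_measurable_continuous_onI[OF cont_trace]
    by (subst integrable_distr_eq) simp_all
  \<comment> \<open>The abstract \<open>D\<close> becomes the iterated third derivative. Components
    of gradient and Hessian are rewritten as Frechet derivatives first, so that the hypotheses on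
    directional derivatives match one level of \<open>C_k_on\<close> each.\<close>
  note id = moment_measure_identities[of \<psi> "gradient \<psi>" "hessian \<psi>"
      "\<lambda>i j k x. frechet_derivative (?h i j) (at x) (axis k 1)" B A, folded \<nu>_def,
      OF \<nu>.finite_measure_axioms C_k_on_imp_continuous_on[OF C3] cont_g cont_h
        C_k_on_imp_continuous_on[OF C0],
      unfolded g_eq h_eq,
      OF C_k_on_Suc_imp_has_dir_deriv[OF C3] C_k_on_Suc_imp_has_dir_deriv[OF C2]
        C_k_on_Suc_imp_has_dir_deriv[OF C1],
      OF B this \<open>transpose A = A\<close>,
      folded f'_def q'_def T_def S_def]
  have transfer: "integrable M (\<lambda>\<omega>. g (U \<omega>))" "(\<integral>\<omega>. g (U \<omega>) \<partial>M) = integral\<^sup>L \<nu> g"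
    if "integrable \<nu> g" for g :: "real^'n \<Rightarrow> real"
  proof -
    have [measurable]: "g \<in> borel_measurable borel"
      using borel_measurable_integrable[OF that] by (simp add: \<nu>_def)
    show "integrable M (\<lambda>\<omega>. g (U \<omega>))" "(\<integral>\<omega>. g (U \<omega>) \<partial>M) = integral\<^sup>L \<nu> g"
      using that by (simp_all add: \<nu> integrable_distr_eq integral_distr)
  qed
  have eqs: "f \<omega> = f' (U \<omega>)" "q \<omega> = q' (U \<omega>)"
    "(A *v Y \<omega>) \<bullet> (H \<omega> *v (A *v Y \<omega>)) = T (U \<omega>)" "trace (A ** H \<omega> ** A ** H \<omega>) = S (U \<omega>)" for \<omega>
    by (simp_all add: f q Y H f'_def q'_def T_def S_def)
  have var: "variance f = (\<integral>x. (f' x)\<^sup>2 \<partial>\<nu>) - (integral\<^sup>L \<nu> f')\<^sup>2"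
    "variance q = (\<integral>x. (q' x)\<^sup>2 \<partial>\<nu>) - (integral\<^sup>L \<nu> q')\<^sup>2"
    unfolding eqs
    using variance_eq[OF transfer(1)[OF id(1)] transfer(1)[OF id(2)]]
      variance_eq[OF transfer(1)[OF id(3)] transfer(1)[OF id(4)]]
      transfer(2)[OF id(1)] transfer(2)[OF id(2)] transfer(2)[OF id(3)] transfer(2)[OF id(4)]
    by simp_all
  have "T_A = integral\<^sup>L \<nu> T" "U_A = integral\<^sup>L \<nu> S"
    unfolding T_A U_A eqs using transfer[OF id(5)] transfer[OF id(6)] by simp_all
  \<comment> \<open>The means of \<open>f'\<close> and \<open>q'\<close> agree by
    \<open>id(7)\<close>, so the variances differ exactly as the second moments do in
    \<open>id(8)\<close>.\<close>
  then have "variance f = variance q - 3 * T_A + U_A"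
    unfolding var using id(7,8) by simp
  then show ?thesis
    unfolding eqs
    using transfer[OF id(2)] transfer[OF id(4)] transfer[OF id(5)] transfer[OF id(6)] by simp
qed

end
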